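(* Let $W\ge1$ and $1\le k^*\le W$ be integers, and let $A,B\in\mathbb{C}^{W\times W}$ be Hermitian positive semidefinite matrices such that: (1) (Hankel decay) there exist constants $C,\alpha>0$ with $\lambda_j(A)\le Ce^{-\alpha j}$ for all $j\ge1$; (2) (Slepian structure) there exist constants $C',c'>0$ with $\lambda_j(B)\le C'$ for $j\le k^*$ and $\sum_{j>k^*}\lambda_j(B)\le e^{-c'W}$. Then there exist constants $K,\alpha'>0$ depending only on $C,\alpha,C',c'$ such that for all integers $s\ge1$ with $sk^*+1\le W$, \[ \lambda_{sk^*+1}(A\circ B)\le Ke^{-\alpha' s}. \] In particular, for every $k$ with $k^*\le k\le W$, $\lambda_k(A\circ B)\le K\exp\!\big(-\alpha'\lfloor k/k^*\rfloor\big)$ (after possibly enlarging $K$).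
   Context: For a Hermitian matrix $M$, $\lambda_1(M)\ge\lambda_2(M)\ge\dots$ denote its eigenvalues in decreasing order. $A\circ B$ denotes the entrywise (Hadamard) product. *)

theory Defs
  imports "Jordan_Normal_Form.Jordan_Normal_Form"
begin

definition hermitian_mat :: "complex mat \<Rightarrow> bool" where
  "hermitian_mat A \<longleftrightarrow> A \<in> carrier_mat (dim_row A) (dim_row A) \<and>
     (\<forall>i < dim_row A. \<forall>j < dim_row A. A $$ (i, j) = cnj (A $$ (j, i)))"

definition psd_mat :: "complex mat \<Rightarrow> bool" where
  "psd_mat A \<longleftrightarrow> hermitian_mat A \<and>
     (\<forall>v \<in> carrier_vec (dim_row A). 0 \<le> Re (scalar_prod (conjugate v) (A *\<^sub>v v)))"

definition eigvals_list :: "complex mat \<Rightarrow> complex list" where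
  "eigvals_list A = (SOME as. char_poly A = (\<Prod>a\<leftarrow>as. [:- a, 1:]))"

text \<open>Real parts of the eigenvalues sorted in decreasing order (for Hermitian
  matrices the eigenvalues are real).\<close>
definition eig_desc :: "complex mat \<Rightarrow> real list" where
  "eig_desc A = rev (sort (map Re (eigvals_list A)))"

text \<open>lambda j A = j-th largest eigenvalue, 1-based (meaningful for 1 \<le> j \<le> dim).\<close>
definition eig_lambda :: "nat \<Rightarrow> complex mat \<Rightarrow> real" where
  "eig_lambda j A = eig_desc A ! (j - 1)"

definition hadamard :: "complex mat \<Rightarrow> complex mat \<Rightarrow> complex mat" where
  "hadamard A B = mat (dim_row A) (dim_col A) (\<lambda>(i, j). A $$ (i, j) * B $$ (i, j))"

end

theory Submission
  imports Defs "Jordan_Normal_Form.Schur_Decomposition"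
begin

text \<open>Diagonalise \<open>B = \<Sum>\<^sub>m \<mu>\<^sub>m v\<^sub>m v\<^sub>m\<^sup>*\<close> and write \<open>q\<^sub>A\<close> for the quadratic form of \<open>A\<close>. The quadratic
  form of \<open>A \<circ> B\<close> at \<open>x\<close> is \<open>\<Sum>\<^sub>m \<mu>\<^sub>m q\<^sub>A(y\<^sub>m)\<close>, where \<open>y\<^sub>m\<close> is the entrywise product of \<open>x\<close> with the
  conjugate of \<open>v\<^sub>m\<close>; taking both matrices to be the identity shows \<open>\<Sum>\<^sub>m |y\<^sub>m|\<^sup>2 = |x|\<^sup>2\<close>.
  If \<open>x\<close> is orthogonal to the \<open>s k\<close> vectors \<open>u\<^sub>l \<circ> v\<^sub>m\<close> with \<open>l \<le> s\<close> and \<open>m \<le> k\<close>, where the \<open>u\<^sub>l\<close> form an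
  eigenbasis of \<open>A\<close>, then \<open>y\<^sub>m\<close> is orthogonal to \<open>u\<^sub>1, \<dots>, u\<^sub>s\<close> for every \<open>m \<le> k\<close>. Hence the terms with
  \<open>m \<le> k\<close> contribute at most \<open>\<lambda>\<^sub>s\<^sub>+\<^sub>1(A) \<lambda>\<^sub>1(B) |x|\<^sup>2\<close> and the others at most
  \<open>\<lambda>\<^sub>1(A) (\<Sum>\<^sub>m\<^sub>>\<^sub>k \<lambda>\<^sub>m(B)) |x|\<^sup>2\<close>. By the Courant--Fischer principle the sum of the two bounds
  \<open>\<lambda>\<^sub>s\<^sub>k\<^sub>+\<^sub>1(A \<circ> B)\<close>, and both decay exponentially in \<open>s\<close>, the second one because \<open>s < W\<close>.\<close>

section \<open>Adjoints and unitary equivalence\<close>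

lemma dim_mat_adjoint [simp]:
  "dim_row (mat_adjoint A) = dim_col A" "dim_col (mat_adjoint A) = dim_row A"
  by (simp_all add: mat_adjoint_def)

lemma mat_adjoint_carrier [simp]:
  "A \<in> carrier_mat n m \<Longrightarrow> mat_adjoint A \<in> carrier_mat m n"
  by (intro carrier_matI) auto

lemma index_mat_adjoint [simp]:
  "i < dim_col A \<Longrightarrow> j < dim_row A \<Longrightarrow> mat_adjoint A $$ (i, j) = conjugate (A $$ (j, i))"
  by (simp add: mat_adjoint_def mat_of_rows_index)

lemma row_mat_adjoint [simp]:
  "i < dim_col A \<Longrightarrow> row (mat_adjoint A) i = conjugate (col A i)"
  by (intro eq_vecI) auto

lemma mat_adjoint_mat_adjoint [simp]: "mat_adjoint (mat_adjoint A) = A"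
  by (rule eq_matI) auto

lemma conjugate_one [simp]: "conjugate 1 = (1 :: 'a :: conjugatable_field)"
  by (metis conjugate_dist_mul conjugate_id mult.left_neutral mult.right_neutral)

lemma mat_adjoint_one [simp]: "mat_adjoint (1\<^sub>m n) = 1\<^sub>m n"
  by (rule eq_matI) auto

lemma mat_adjoint_mult:
  assumes "A \<in> carrier_mat n m" "B \<in> carrier_mat m k"
  shows "mat_adjoint (A * B) = mat_adjoint B * mat_adjoint A"
  using assms
  by (intro eq_matI) (auto simp: scalar_prod_def sum_conjugate conjugate_dist_mul mult.commute)

lemma mat_adjoint_four_block_diag:
  assumes "A \<in> carrier_mat n n" "B \<in> carrier_mat m m"
  shows "mat_adjoint (four_block_mat A (0\<^sub>m n m) (0\<^sub>m m n) B) =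
    four_block_mat (mat_adjoint A) (0\<^sub>m n m) (0\<^sub>m m n) (mat_adjoint B)"
  using assms by (intro eq_matI) auto

lemma scalar_prod_conjugate_mult_mat_vec:
  fixes A :: "'a :: conjugatable_field mat"
  assumes A: "A \<in> carrier_mat n m" and x: "x \<in> carrier_vec n" and y: "y \<in> carrier_vec m"
  shows "conjugate x \<bullet> (A *\<^sub>v y) = conjugate (mat_adjoint A *\<^sub>v x) \<bullet> y"
proof -
  have "conjugate (mat_adjoint A *\<^sub>v x) = transpose_mat A *\<^sub>v conjugate x"
    using A x by (intro eq_vecI) (simp_all add: conjugate_sprod_vec[of _ n])
  then show ?thesis
    using transpose_vec_mult_scalar[OF A y, of "conjugate x"] x by simp
qed

lemma hermitian_matD:
  assumes "hermitian_mat A" "A \<in> carrier_mat n n" "i < n" "j < n"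
  shows "A $$ (i, j) = cnj (A $$ (j, i))"
  using assms unfolding hermitian_mat_def by (metis carrier_matD(1))

lemma hermitian_matI:
  assumes "A \<in> carrier_mat n n" "\<And>i j. i < n \<Longrightarrow> j < n \<Longrightarrow> A $$ (i, j) = cnj (A $$ (j, i))"
  shows "hermitian_mat A"
  using assms unfolding hermitian_mat_def by (metis carrier_matD(1))

lemma hermitian_mat_iff_mat_adjoint:
  assumes "A \<in> carrier_mat n n"
  shows "hermitian_mat A \<longleftrightarrow> mat_adjoint A = A"
proof
  assume "hermitian_mat A"
  then show "mat_adjoint A = A"
    using assms by (intro eq_matI) (simp_all add: hermitian_matD[of A n, symmetric])
next
  assume "mat_adjoint A = A"
  then have "A $$ (i, j) = cnj (A $$ (j, i))" if "i < n" "j < n" for i j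
    using index_mat_adjoint[of i A j] assms that by simp
  then show "hermitian_mat A"
    using assms by (rule hermitian_matI[rotated])
qed

definition unitary_mat :: "nat \<Rightarrow> 'a :: conjugatable_field mat \<Rightarrow> bool" where
  "unitary_mat n U \<longleftrightarrow>
    U \<in> carrier_mat n n \<and> mat_adjoint U * U = 1\<^sub>m n \<and> U * mat_adjoint U = 1\<^sub>m n"

lemma unitary_matI:
  assumes "U \<in> carrier_mat n n" "mat_adjoint U * U = 1\<^sub>m n"
  shows "unitary_mat n U"
  using assms mat_mult_left_right_inverse[OF mat_adjoint_carrier[OF assms(1)] assms(1)]
  by (simp add: unitary_mat_def)

lemma unitary_matD:
  assumes "unitary_mat n U"
  shows "U \<in> carrier_mat n n" "mat_adjoint U * U = 1\<^sub>m n" "U * mat_adjoint U = 1\<^sub>m n"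
  using assms by (auto simp: unitary_mat_def)

lemma unitary_mat_col_carrier: "unitary_mat n U \<Longrightarrow> col U j \<in> carrier_vec n"
  using unitary_matD(1)[of n U] by (auto intro: carrier_vecI)

definition unitarily_equiv :: "'a :: conjugatable_field mat \<Rightarrow> 'a mat \<Rightarrow> 'a mat \<Rightarrow> bool" where
  "unitarily_equiv A B U \<longleftrightarrow> similar_mat_wit A B U (mat_adjoint U)"

lemma unitarily_equivD:
  assumes "unitarily_equiv A B U" "A \<in> carrier_mat n n"
  shows "unitary_mat n U" "B \<in> carrier_mat n n" "A = U * B * mat_adjoint U"
  using similar_mat_witD2[OF assms(2) assms(1)[unfolded unitarily_equiv_def]]
  by (simp_all only: unitary_mat_def simp_thms)

lemma unitarily_equiv_conjugation:
  assumes "A \<in> carrier_mat n n" "unitary_mat n U"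
  shows "unitarily_equiv A (mat_adjoint U * A * U) U"
  unfolding unitarily_equiv_def
  by (rule similar_mat_wit_sym, rule similar_mat_witI[where n = n])
    (use assms unitary_matD[OF assms(2)] in \<open>simp_all add: mult_carrier_mat[of _ n n _ n]\<close>)

lemma unitarily_equiv_trans:
  assumes "unitarily_equiv A B U" "unitarily_equiv B C V"
  shows "unitarily_equiv A C (U * V)"
proof -
  obtain n where A: "A \<in> carrier_mat n n"
    using assms(1) by (auto simp: unitarily_equiv_def similar_mat_wit_def Let_def)
  note U = unitarily_equivD[OF assms(1) A]
  note V = unitarily_equivD[OF assms(2) U(2)]
  show ?thesis
    using similar_mat_wit_trans[OF assms[unfolded unitarily_equiv_def]]
    unfolding unitarily_equiv_def
      mat_adjoint_mult[OF unitary_matD(1)[OF U(1)] unitary_matD(1)[OF V(1)]] .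
qed

lemma unitarily_equiv_four_block_diag:
  assumes "unitarily_equiv A\<^sub>1 B\<^sub>1 U\<^sub>1" "unitarily_equiv A\<^sub>2 B\<^sub>2 U\<^sub>2"
    and A\<^sub>1: "A\<^sub>1 \<in> carrier_mat n n" and A\<^sub>2: "A\<^sub>2 \<in> carrier_mat m m"
  shows "unitarily_equiv (four_block_mat A\<^sub>1 (0\<^sub>m n m) (0\<^sub>m m n) A\<^sub>2)
    (four_block_mat B\<^sub>1 (0\<^sub>m n m) (0\<^sub>m m n) B\<^sub>2) (four_block_mat U\<^sub>1 (0\<^sub>m n m) (0\<^sub>m m n) U\<^sub>2)"
proof -
  have U\<^sub>1: "U\<^sub>1 \<in> carrier_mat n n" and U\<^sub>2: "U\<^sub>2 \<in> carrier_mat m m"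
    using unitarily_equivD(1)[OF assms(1) A\<^sub>1] unitarily_equivD(1)[OF assms(2) A\<^sub>2]
    by (auto dest: unitary_matD)
  show ?thesis
    unfolding unitarily_equiv_def mat_adjoint_four_block_diag[OF U\<^sub>1 U\<^sub>2]
    by (rule similar_mat_wit_four_block[OF assms(1,2)[unfolded unitarily_equiv_def]])
      (use A\<^sub>1 A\<^sub>2 U\<^sub>1 U\<^sub>2 in simp_all)
qed

lemma unitarily_equiv_refl:
  "A \<in> carrier_mat n n \<Longrightarrow> unitarily_equiv A A (1\<^sub>m n)"
  using similar_mat_wit_refl by (auto simp: unitarily_equiv_def)

lemma hermitian_mat_unitarily_equiv:
  assumes "hermitian_mat A" "unitarily_equiv A B U"
  shows "hermitian_mat B"
proof -
  define n where "n = dim_row A"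
  have A: "A \<in> carrier_mat n n"
    using assms(1) by (simp add: hermitian_mat_def n_def)
  note U = unitarily_equivD[OF assms(2) A]
  note carrier = A unitary_matD(1)[OF U(1)]
  have "similar_mat_wit B A (mat_adjoint U) U"
    using assms(2) unfolding unitarily_equiv_def by (rule similar_mat_wit_sym)
  then have B: "B = mat_adjoint U * A * U"
    by (rule similar_mat_witD(3)[OF refl])
  have "mat_adjoint B = B"
    using carrier assms(1)[unfolded hermitian_mat_iff_mat_adjoint[OF A]] unfolding B
    by (simp add: mat_adjoint_mult[of _ n n _ n] assoc_mult_mat[of _ n n _ n _ n]
        mult_carrier_mat[of _ n n _ n])
  then show ?thesis
    using hermitian_mat_iff_mat_adjoint[OF U(2)] by simp
qed

section \<open>The spectral theorem for Hermitian matrices\<close>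

lemma corthogonal_completion:
  fixes v :: "'a :: conjugatable_ordered_field vec"
  assumes v: "v \<in> carrier_vec n" "v \<noteq> 0\<^sub>v n"
  obtains ws where "set ws \<subseteq> carrier_vec n" "corthogonal ws" "length ws = n" "0 < n" "ws ! 0 = v"
proof -
  interpret cof_vec_space n "TYPE('a)" .
  define ws where "ws = gram_schmidt n (basis_completion v)"
  note completion = basis_completion[OF v]
  have ws: "set ws \<subseteq> carrier_vec n" "corthogonal ws" "length ws = n"
    using gram_schmidt_result[OF completion(2,4,5) refl, folded ws_def] completion(6) by simp_all
  have n: "0 < n"
    using v by (cases n) auto
  obtain vs where "basis_completion v = v # vs"
    by (simp add: basis_completion_def Let_def)
  then have "hd ws = v"
    using gram_schmidt_hd[OF v(1)] by (simp add: ws_def)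
  then have "ws ! 0 = v"
    using ws(3) n by (cases ws) auto
  then show thesis
    using that ws n by blast
qed

definition normalize_vec :: "complex vec \<Rightarrow> complex vec" where
  "normalize_vec v = complex_of_real (1 / sqrt (Re (v \<bullet>c v))) \<cdot>\<^sub>v v"

lemma normalize_vec_carrier [simp]: "v \<in> carrier_vec n \<Longrightarrow> normalize_vec v \<in> carrier_vec n"
  by (simp add: normalize_vec_def)

lemma cscalar_prod_normalize_vec:
  assumes "v \<in> carrier_vec n" "w \<in> carrier_vec n"
  shows "normalize_vec v \<bullet>c normalize_vec w =
    (v \<bullet>c w) / complex_of_real (sqrt (Re (v \<bullet>c v)) * sqrt (Re (w \<bullet>c w)))"
  using assms by (simp add: normalize_vec_def conjugate_smult_vec)

lemma cscalar_prod_normalize_vec_self: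
  assumes v: "v \<in> carrier_vec n" "v \<bullet>c v \<noteq> 0"
  shows "normalize_vec v \<bullet>c normalize_vec v = 1"
proof -
  have "0 < v \<bullet>c v"
    using v by auto
  then have "v \<bullet>c v = complex_of_real (Re (v \<bullet>c v))" "0 < Re (v \<bullet>c v)"
    by (auto simp: less_complex_def complex_eq_iff)
  then show ?thesis
    unfolding cscalar_prod_normalize_vec[OF v(1) v(1)]
    by (metis abs_of_pos divide_self_if less_irrefl of_real_eq_0_iff real_sqrt_mult_self)
qed

lemma unitary_mat_normalized_cols:
  assumes ws: "set ws \<subseteq> carrier_vec n" "corthogonal ws" "length ws = n"
  shows "unitary_mat n (mat_of_cols n (map normalize_vec ws))"
proof (rule unitary_matI)
  define U where "U = mat_of_cols n (map normalize_vec ws)"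
  have nth: "ws ! i \<in> carrier_vec n" if "i < n" for i
    using ws that by auto
  have col: "col U i = normalize_vec (ws ! i)" if "i < n" for i
    unfolding U_def using ws(3) that nth[OF that]
    by (subst col_mat_of_cols) auto
  show U: "U \<in> carrier_mat n n"
    unfolding U_def using ws(3) mat_of_cols_carrier(1)[of n "map normalize_vec ws"] by simp
  show "mat_adjoint U * U = 1\<^sub>m n"
  proof (rule eq_matI)
    fix i j assume "i < dim_row (1\<^sub>m n)" "j < dim_col (1\<^sub>m n)"
    then have i: "i < n" and j: "j < n" by auto
    have "(mat_adjoint U * U) $$ (i, j) = normalize_vec (ws ! j) \<bullet>c normalize_vec (ws ! i)"
      using i j U col nth by (simp add: conjugate_vec_sprod_comm[of _ n])
    also have "\<dots> = 1\<^sub>m n $$ (i, j)"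
      using corthogonalD[OF ws(2), of j i] ws(3) i j
        cscalar_prod_normalize_vec[OF nth[OF j] nth[OF i]]
        cscalar_prod_normalize_vec_self[OF nth[OF i]]
      by (cases "i = j") simp_all
    finally show "(mat_adjoint U * U) $$ (i, j) = 1\<^sub>m n $$ (i, j)" .
  qed (use U in auto)
qed

lemma unitary_mat_completion:
  fixes v :: "complex vec"
  assumes v: "v \<in> carrier_vec n" "v \<noteq> 0\<^sub>v n"
  obtains U where "unitary_mat n U" "col U 0 = normalize_vec v"
proof -
  obtain ws where ws: "set ws \<subseteq> carrier_vec n" "corthogonal ws" "length ws = n"
    and "0 < n" "ws ! 0 = v"
    using corthogonal_completion[OF v] .
  then have "col (mat_of_cols n (map normalize_vec ws)) 0 = normalize_vec v"
    using v by (subst col_mat_of_cols) auto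
  with unitary_mat_normalized_cols[OF ws] show thesis
    using that by blast
qed

lemma col_unitary_conjugation_eigenvector:
  assumes A: "A \<in> carrier_mat n n" and U: "unitary_mat n U" and j: "j < n"
    and eigen: "A *\<^sub>v col U j = a \<cdot>\<^sub>v col U j"
  shows "col (mat_adjoint U * A * U) j = a \<cdot>\<^sub>v unit_vec n j"
proof -
  note carrier = unitary_matD(1)[OF U] mat_adjoint_carrier[OF unitary_matD(1)[OF U]]
  note col = unitary_mat_col_carrier[OF U]
  have "col (mat_adjoint U * A * U) j = mat_adjoint U *\<^sub>v (A *\<^sub>v col U j)"
    using A carrier col j by (simp add: col_mult2[of _ n n _ n] mult_carrier_mat[of _ n n]
        assoc_mult_mat_vec[of _ n n _ n])
  also have "\<dots> = a \<cdot>\<^sub>v col (mat_adjoint U * U) j"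
    using carrier col j by (simp add: eigen mult_mat_vec[of _ n n] col_mult2[of _ n n _ n])
  also have "\<dots> = a \<cdot>\<^sub>v unit_vec n j"
    using j by (simp add: unitary_matD(2)[OF U])
  finally show ?thesis .
qed

lemma hermitian_mat_deflation:
  assumes A: "A \<in> carrier_mat (Suc n) (Suc n)" "hermitian_mat A" and e: "eigenvalue A e"
  obtains U A' where "A' \<in> carrier_mat n n" "hermitian_mat A'"
    "unitarily_equiv A (four_block_mat (mat 1 1 (\<lambda>_. e)) (0\<^sub>m 1 n) (0\<^sub>m n 1) A') U"
proof -
  obtain v where v: "v \<in> carrier_vec (Suc n)" "v \<noteq> 0\<^sub>v (Suc n)" and Av: "A *\<^sub>v v = e \<cdot>\<^sub>v v"
    using A e by (auto simp: eigenvalue_def eigenvector_def)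
  obtain U where U: "unitary_mat (Suc n) U" and col_U: "col U 0 = normalize_vec v"
    using unitary_mat_completion[OF v] .
  define M where "M = mat_adjoint U * A * U"
  have equiv: "unitarily_equiv A M U"
    unfolding M_def using A(1) U by (rule unitarily_equiv_conjugation)
  note M = unitarily_equivD(2)[OF equiv A(1)]
  have hermitian_M: "hermitian_mat M"
    using A(2) equiv by (rule hermitian_mat_unitarily_equiv)
  have "A *\<^sub>v col U 0 = e \<cdot>\<^sub>v col U 0"
    using A(1) v by (simp add: col_U normalize_vec_def mult_mat_vec[of _ "Suc n" "Suc n"] Av
        smult_smult_assoc mult.commute)
  then have col_M: "col M 0 = e \<cdot>\<^sub>v unit_vec (Suc n) 0"
    unfolding M_def using A(1) U by (intro col_unitary_conjugation_eigenvector) simp_all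
  have first_col: "M $$ (i, 0) = (if i = 0 then e else 0)" if "i < Suc n" for i
    using arg_cong[OF col_M, of "\<lambda>w. w $ i"] that M by (auto simp: unit_vec_def)
  have first_row: "M $$ (0, i) = (if i = 0 then e else 0)" if "i < Suc n" for i
  proof -
    have "M $$ (0, i) = cnj (M $$ (i, 0))"
      using hermitian_matD[OF hermitian_M M _ that] by simp
    then show ?thesis
      using first_col[OF that] first_col[of 0] by auto
  qed
  define A' where "A' = mat n n (\<lambda>(i, j). M $$ (Suc i, Suc j))"
  have "A' \<in> carrier_mat n n"
    by (simp add: A'_def)
  moreover have "hermitian_mat A'"
    by (intro hermitian_matI[of _ n]) (auto simp: A'_def intro: hermitian_matD[OF hermitian_M M])
  moreover have "M = four_block_mat (mat 1 1 (\<lambda>_. e)) (0\<^sub>m 1 n) (0\<^sub>m n 1) A'"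
    using M first_col first_row by (intro eq_matI) (auto simp: A'_def)
  ultimately show thesis
    using that equiv by blast
qed

lemma length_linear_factors_char_poly:
  assumes "A \<in> carrier_mat n n" "char_poly A = (\<Prod>a\<leftarrow>as. [:- a, 1:])"
  shows "length as = n"
  using degree_linear_factors[of uminus as] degree_monic_char_poly[OF assms(1)] assms(2) by simp

theorem hermitian_mat_unitarily_diagonalizable:
  assumes "A \<in> carrier_mat n n" "hermitian_mat A" "char_poly A = (\<Prod>a\<leftarrow>as. [:- a, 1:])"
  shows "\<exists>U. unitarily_equiv A (mat_diag n ((!) as)) U"
  using assms
proof (induction as arbitrary: n A)
  case Nil
  then have "n = 0"
    using length_linear_factors_char_poly[OF Nil.prems(1,3)] by simp
  then have "A = mat_diag n ((!) [])"
    using Nil.prems(1) by (intro eq_matI) (auto simp: mat_diag_def)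
  then show ?case
    using unitarily_equiv_refl[OF Nil.prems(1)] by auto
next
  case (Cons a as N A)
  obtain n where N: "N = Suc n"
    using length_linear_factors_char_poly[OF Cons.prems(1,3)] by auto
  note A = Cons.prems(1)[unfolded N]
  let ?a = "mat 1 1 (\<lambda>_. a)"
  have "eigenvalue A a"
    unfolding eigenvalue_root_char_poly[OF A] Cons.prems(3) by simp
  then obtain U A' where A': "A' \<in> carrier_mat n n" "hermitian_mat A'"
    and U: "unitarily_equiv A (four_block_mat ?a (0\<^sub>m 1 n) (0\<^sub>m n 1) A') U"
    using hermitian_mat_deflation[OF A Cons.prems(2)] by blast
  have "char_poly A = char_poly (four_block_mat ?a (0\<^sub>m 1 n) (0\<^sub>m n 1) A')"
    using U by (intro char_poly_similar) (auto simp: unitarily_equiv_def similar_mat_def)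
  also have "\<dots> = char_poly ?a * char_poly A'"
    by (rule char_poly_four_block_zeros_col[OF _ _ A'(1)]) auto
  also have "char_poly ?a = [:- a, 1:]"
    by (simp add: char_poly_defs det_def sign_def)
  finally have "char_poly A' = (\<Prod>a\<leftarrow>as. [:- a, 1:])"
    using Cons.prems(3) by (simp del: mult_pCons_left)
  then obtain V where V: "unitarily_equiv A' (mat_diag n ((!) as)) V"
    using Cons.IH[OF A'] by blast
  have "four_block_mat ?a (0\<^sub>m 1 n) (0\<^sub>m n 1) (mat_diag n ((!) as)) = mat_diag N ((!) (a # as))"
    by (rule eq_matI) (auto simp: N mat_diag_def nth_Cons')
  then show ?case
    using unitarily_equiv_trans[OF U]
      unitarily_equiv_four_block_diag[OF unitarily_equiv_refl V _ A'(1)]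
    by (metis mat_carrier)
qed

lemma char_poly_eigvals_list:
  assumes "A \<in> carrier_mat n n"
  shows "char_poly A = (\<Prod>a\<leftarrow>eigvals_list A. [:- a, 1:])"
  using char_poly_factorized[OF assms] unfolding eigvals_list_def
  by (metis (mono_tags, lifting) someI_ex)

lemma length_eig_desc: "A \<in> carrier_mat n n \<Longrightarrow> length (eig_desc A) = n"
  using length_linear_factors_char_poly[OF _ char_poly_eigvals_list] by (simp add: eig_desc_def)

lemma eig_lambda_antimono:
  assumes "A \<in> carrier_mat n n" "l \<le> m" "m < n"
  shows "eig_lambda (Suc m) A \<le> eig_lambda (Suc l) A"
  unfolding eig_lambda_def
  by (rule sorted_rev_nth_mono) (use assms length_eig_desc[OF assms(1)] in \<open>auto simp: eig_desc_def\<close>)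

lemma hermitian_mat_eigvals_real:
  assumes A: "A \<in> carrier_mat n n" "hermitian_mat A"
  shows "set (eigvals_list A) \<subseteq> \<real>"
proof
  fix a assume "a \<in> set (eigvals_list A)"
  then obtain l where l: "l < n" "a = eigvals_list A ! l"
    using length_linear_factors_char_poly[OF A(1) char_poly_eigvals_list[OF A(1)]]
    by (metis in_set_conv_nth)
  obtain U where "unitarily_equiv A (mat_diag n ((!) (eigvals_list A))) U"
    using hermitian_mat_unitarily_diagonalizable[OF A char_poly_eigvals_list[OF A(1)]] by blast
  then have "hermitian_mat (mat_diag n ((!) (eigvals_list A)))"
    by (rule hermitian_mat_unitarily_equiv[OF A(2)])
  then show "a \<in> \<real>"
    using hermitian_matD[OF _ mat_diag_dim l(1) l(1)] l by (force simp: mat_diag_def Reals_cnj_iff)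
qed

lemma hermitian_mat_char_poly_eig_desc:
  assumes A: "A \<in> carrier_mat n n" "hermitian_mat A"
  shows "char_poly A = (\<Prod>a\<leftarrow>map complex_of_real (eig_desc A). [:- a, 1:])"
proof -
  have "map complex_of_real (map Re (eigvals_list A)) = eigvals_list A"
    using hermitian_mat_eigvals_real[OF A] by (auto intro!: map_idI simp: of_real_Re)
  then have "mset (eigvals_list A) = mset (map complex_of_real (eig_desc A))"
    by (metis eig_desc_def mset_map mset_rev mset_sort)
  then show ?thesis
    unfolding char_poly_eigvals_list[OF A(1)] prod_mset_prod_list[symmetric] mset_map by simp
qed

abbreviation real_diag_mat :: "nat \<Rightarrow> (nat \<Rightarrow> real) \<Rightarrow> complex mat" where
  "real_diag_mat n d \<equiv> mat_diag n (\<lambda>l. complex_of_real (d l))"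

theorem hermitian_mat_spectral:
  assumes A: "A \<in> carrier_mat n n" "hermitian_mat A"
  obtains U where "unitarily_equiv A (real_diag_mat n (\<lambda>l. eig_lambda (Suc l) A)) U"
proof -
  have "mat_diag n ((!) (map complex_of_real (eig_desc A))) =
      real_diag_mat n (\<lambda>l. eig_lambda (Suc l) A)"
    using length_eig_desc[OF A(1)] by (intro eq_matI) (auto simp: mat_diag_def eig_lambda_def)
  then show thesis
    using that hermitian_mat_unitarily_diagonalizable[OF A hermitian_mat_char_poly_eig_desc[OF A]]
    by auto
qed

section \<open>Quadratic forms and eigenvalues\<close>

definition quad_form :: "complex mat \<Rightarrow> complex vec \<Rightarrow> real" where
  "quad_form A x = Re (conjugate x \<bullet> (A *\<^sub>v x))"

definition sq_norm :: "complex vec \<Rightarrow> real" where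
  "sq_norm x = (\<Sum>i<dim_vec x. (cmod (x $ i))\<^sup>2)"

lemma sq_norm_nonneg: "0 \<le> sq_norm x"
  by (simp add: sq_norm_def sum_nonneg)

lemma sq_norm_pos:
  assumes "x \<in> carrier_vec n" "x \<noteq> 0\<^sub>v n"
  shows "0 < sq_norm x"
proof -
  obtain i where "i < n" "x $ i \<noteq> 0"
    using assms by (metis carrier_vecD eq_vecI index_zero_vec(1) index_zero_vec(2))
  then show ?thesis
    using assms(1) by (auto simp: sq_norm_def intro!: sum_pos2[of _ i])
qed

lemma quad_form_eq_sum:
  assumes "A \<in> carrier_mat n n" "x \<in> carrier_vec n"
  shows "quad_form A x = Re (\<Sum>i<n. \<Sum>j<n. cnj (x $ i) * A $$ (i, j) * x $ j)"
  using assms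
  by (simp add: quad_form_def scalar_prod_def atLeast0LessThan sum_distrib_left mult.assoc)

lemma quad_form_real_diag_mat:
  assumes "x \<in> carrier_vec n"
  shows "quad_form (real_diag_mat n d) x = (\<Sum>l<n. d l * (cmod (x $ l))\<^sup>2)"
proof -
  have "cnj (x $ i) * real_diag_mat n d $$ (i, j) * x $ j =
      (if j = i then complex_of_real (d i * (cmod (x $ i))\<^sup>2) else 0)" if "i < n" "j < n" for i j
    using that by (simp add: mat_diag_def complex_norm_square mult_ac del: of_real_power)
  then show ?thesis
    using assms by (simp add: quad_form_eq_sum[of _ n])
qed

lemma quad_form_one: "x \<in> carrier_vec n \<Longrightarrow> quad_form (1\<^sub>m n) x = sq_norm x"
  using quad_form_real_diag_mat[of x n "\<lambda>_. 1"] by (simp add: sq_norm_def)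

lemma quad_form_conjugation:
  assumes "A \<in> carrier_mat m m" "U \<in> carrier_mat n m" "x \<in> carrier_vec n"
  shows "quad_form (U * A * mat_adjoint U) x = quad_form A (mat_adjoint U *\<^sub>v x)"
proof -
  have U: "mat_adjoint U \<in> carrier_mat m n" "mat_adjoint U *\<^sub>v x \<in> carrier_vec m"
    using assms(2) by (simp_all add: carrier_vecI)
  then have mult_vec_assoc: "U * A * mat_adjoint U *\<^sub>v x = U *\<^sub>v (A *\<^sub>v (mat_adjoint U *\<^sub>v x))"
    using assms by (simp add: assoc_mult_mat_vec[of _ n m _ n] assoc_mult_mat_vec[of _ n m _ m]
        mult_carrier_mat[of _ n m _ m])
  then show ?thesis
    using scalar_prod_conjugate_mult_mat_vec[OF assms(2,3)] mult_mat_vec_carrier[OF assms(1) U(2)]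
    unfolding quad_form_def mult_vec_assoc by simp
qed

lemma parseval_unitary_mat:
  assumes "unitary_mat n U" "x \<in> carrier_vec n"
  shows "(\<Sum>l<n. (cmod ((mat_adjoint U *\<^sub>v x) $ l))\<^sup>2) = sq_norm x"
proof -
  note U = unitary_matD[OF assms(1)]
  have "sq_norm x = quad_form (U * 1\<^sub>m n * mat_adjoint U) x"
    using U assms(2) by (simp add: quad_form_one)
  also have "\<dots> = quad_form (1\<^sub>m n) (mat_adjoint U *\<^sub>v x)"
    by (rule quad_form_conjugation[OF one_carrier_mat U(1) assms(2)])
  also have "\<dots> = sq_norm (mat_adjoint U *\<^sub>v x)"
    using U(1) by (intro quad_form_one) (simp add: carrier_vecI)
  finally show ?thesis
    using U(1) by (simp add: sq_norm_def)
qed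

lemma quad_form_unitarily_equiv_diag:
  assumes "A \<in> carrier_mat n n" "unitarily_equiv A (real_diag_mat n d) U" "x \<in> carrier_vec n"
  shows "quad_form A x = (\<Sum>l<n. d l * (cmod ((mat_adjoint U *\<^sub>v x) $ l))\<^sup>2)"
proof -
  note U = unitarily_equivD[OF assms(2,1)]
  have "quad_form A x = quad_form (real_diag_mat n d) (mat_adjoint U *\<^sub>v x)"
    using quad_form_conjugation[OF U(2) unitary_matD(1)[OF U(1)] assms(3)] U(3) by simp
  also have "\<dots> = (\<Sum>l<n. d l * (cmod ((mat_adjoint U *\<^sub>v x) $ l))\<^sup>2)"
    using unitary_matD(1)[OF U(1)] by (intro quad_form_real_diag_mat) (auto intro: carrier_vecI)
  finally show ?thesis .
qed

lemma quad_form_le_of_spectral_support: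
  assumes A: "A \<in> carrier_mat n n" "unitarily_equiv A (real_diag_mat n d) U"
    and x: "x \<in> carrier_vec n"
    and support: "\<And>l. l < n \<Longrightarrow> (mat_adjoint U *\<^sub>v x) $ l \<noteq> 0 \<Longrightarrow> d l \<le> c"
  shows "quad_form A x \<le> c * sq_norm x"
  unfolding quad_form_unitarily_equiv_diag[OF A x] sum_distrib_left
    parseval_unitary_mat[OF unitarily_equivD(1)[OF A(2,1)] x, symmetric]
proof (rule sum_mono)
  fix l assume "l \<in> {..<n}"
  then show "d l * (cmod ((mat_adjoint U *\<^sub>v x) $ l))\<^sup>2 \<le> c * (cmod ((mat_adjoint U *\<^sub>v x) $ l))\<^sup>2"
    using support[of l] by (cases "(mat_adjoint U *\<^sub>v x) $ l = 0") (auto intro: mult_right_mono)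
qed

lemma quad_form_ge_of_spectral_support:
  assumes A: "A \<in> carrier_mat n n" "unitarily_equiv A (real_diag_mat n d) U"
    and x: "x \<in> carrier_vec n"
    and support: "\<And>l. l < n \<Longrightarrow> (mat_adjoint U *\<^sub>v x) $ l \<noteq> 0 \<Longrightarrow> c \<le> d l"
  shows "c * sq_norm x \<le> quad_form A x"
  unfolding quad_form_unitarily_equiv_diag[OF A x] sum_distrib_left
    parseval_unitary_mat[OF unitarily_equivD(1)[OF A(2,1)] x, symmetric]
proof (rule sum_mono)
  fix l assume "l \<in> {..<n}"
  then show "c * (cmod ((mat_adjoint U *\<^sub>v x) $ l))\<^sup>2 \<le> d l * (cmod ((mat_adjoint U *\<^sub>v x) $ l))\<^sup>2"
    using support[of l] by (cases "(mat_adjoint U *\<^sub>v x) $ l = 0") (auto intro: mult_right_mono)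
qed

lemma psd_mat_eig_lambda_nonneg:
  assumes A: "A \<in> carrier_mat n n" "psd_mat A" and l: "l < n"
  shows "0 \<le> eig_lambda (Suc l) A"
proof -
  obtain U where equiv: "unitarily_equiv A (real_diag_mat n (\<lambda>l. eig_lambda (Suc l) A)) U"
    using hermitian_mat_spectral[of A n] A by (auto simp: psd_mat_def)
  note U = unitary_matD[OF unitarily_equivD(1)[OF equiv A(1)]]
  note x = unitary_mat_col_carrier[OF unitarily_equivD(1)[OF equiv A(1)], of l]
  have "mat_adjoint U *\<^sub>v col U l = unit_vec n l"
    using col_mult2[of "mat_adjoint U" n n U n l] U l by simp
  then have "quad_form A (col U l) =
      (\<Sum>m<n. if m = l then eig_lambda (Suc l) A else 0)"
    unfolding quad_form_unitarily_equiv_diag[OF A(1) equiv x] using l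
    by (intro sum.cong refl) (auto simp: unit_vec_def)
  also have "\<dots> = eig_lambda (Suc l) A"
    using l by simp
  finally show ?thesis
    using A x by (auto simp: psd_mat_def quad_form_def)
qed

lemma exists_nonzero_vec_scalar_prod_eq_0:
  fixes W :: "'a :: field vec set"
  assumes W: "finite W" "W \<subseteq> carrier_vec n" "card W < n"
  obtains x where "x \<in> carrier_vec n" "x \<noteq> 0\<^sub>v n" "\<And>w. w \<in> W \<Longrightarrow> w \<bullet> x = 0"
proof -
  obtain ws where ws: "set ws = W" "length ws = card W"
    using finite_distinct_list[OF W(1)] distinct_card by metis
  define G where "G = mat\<^sub>r n n
    (\<lambda>i. if i = card W then 0\<^sub>v n else if i < card W then ws ! i else 0\<^sub>v n)"
  have G: "G \<in> carrier_mat n n"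
    by (simp add: G_def)
  have "ws ! i \<in> carrier_vec n" if "i < card W" for i
    using W(2) ws that by (metis nth_mem subsetD)
  then have "det G = 0"
    unfolding G_def using W(3) by (intro det_row_0) auto
  then obtain x where x: "x \<in> carrier_vec n" "x \<noteq> 0\<^sub>v n" "G *\<^sub>v x = 0\<^sub>v n"
    using det_0_iff_vec_prod_zero_field[OF G] by blast
  have "w \<bullet> x = 0" if "w \<in> W" for w
  proof -
    obtain i where i: "i < card W" "w = ws ! i"
      using \<open>w \<in> W\<close> ws by (metis in_set_conv_nth)
    then have "row G i = w"
      using W ws \<open>w \<in> W\<close> by (auto simp: G_def)
    then have "w \<bullet> x = (G *\<^sub>v x) $ i"
      using G i(1) W(3) by simp
    then show ?thesis
      using x(3) i(1) W(3) by simp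
  qed
  then show thesis
    using that x by blast
qed

text \<open>The upper half of the Courant--Fischer principle. The constraints in \<open>W\<close> and the
  \<open>n - r - 1\<close> constraints of orthogonality to the eigenvectors beyond the first \<open>r + 1\<close> are
  together fewer than \<open>n\<close>, hence have a common nonzero solution.\<close>

lemma eig_lambda_le_of_quad_form_le:
  assumes A: "A \<in> carrier_mat n n" "hermitian_mat A"
    and W: "finite W" "W \<subseteq> carrier_vec n" "card W \<le> r" and r: "r < n"
    and le: "\<And>x. x \<in> carrier_vec n \<Longrightarrow> (\<And>w. w \<in> W \<Longrightarrow> w \<bullet> x = 0) \<Longrightarrow>
      quad_form A x \<le> c * sq_norm x"
  shows "eig_lambda (Suc r) A \<le> c"
proof -
  obtain U where equiv: "unitarily_equiv A (real_diag_mat n (\<lambda>l. eig_lambda (Suc l) A)) U"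
    using hermitian_mat_spectral[OF A] .
  note U = unitary_matD(1)[OF unitarily_equivD(1)[OF equiv A(1)]]
  define R where "R = row (mat_adjoint U) ` {Suc r..<n}"
  have "card (W \<union> R) \<le> card W + card R"
    by (rule card_Un_le)
  also have "\<dots> \<le> r + (n - Suc r)"
    using W(3) card_image_le[of "{Suc r..<n}" "row (mat_adjoint U)"] by (simp add: R_def add_mono)
  finally have "card (W \<union> R) < n"
    using r by simp
  moreover have "finite (W \<union> R)" "W \<union> R \<subseteq> carrier_vec n"
    using W U by (auto simp: R_def)
  ultimately obtain x where x: "x \<in> carrier_vec n" "x \<noteq> 0\<^sub>v n"
    and orth: "\<And>w. w \<in> W \<union> R \<Longrightarrow> w \<bullet> x = 0"
    using exists_nonzero_vec_scalar_prod_eq_0 by metis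
  have "eig_lambda (Suc r) A * sq_norm x \<le> quad_form A x"
  proof (rule quad_form_ge_of_spectral_support[OF A(1) equiv x(1)])
    fix l assume l: "l < n" "(mat_adjoint U *\<^sub>v x) $ l \<noteq> 0"
    then have "row (mat_adjoint U) l \<notin> R"
      using orth U by auto
    then have "l \<le> r"
      using l(1) by (auto simp: R_def)
    then show "eig_lambda (Suc r) A \<le> eig_lambda (Suc l) A"
      using eig_lambda_antimono[OF A(1) _ r] by simp
  qed
  also have "\<dots> \<le> c * sq_norm x"
    using le x(1) orth by simp
  finally show ?thesis
    using sq_norm_pos[OF x] by simp
qed

section \<open>Eigenvalues of Hadamard products\<close>

lemma component_mult_carrier [simp]:
  "v \<in> carrier_vec n \<Longrightarrow> w \<in> carrier_vec n \<Longrightarrow> component_mult v w \<in> carrier_vec n"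
  by (intro carrier_vecI) (simp add: component_mult_def)

lemma hadamard_carrier [simp]:
  "A \<in> carrier_mat n m \<Longrightarrow> hadamard A B \<in> carrier_mat n m"
  by (auto simp: hadamard_def)

lemma hermitian_mat_hadamard:
  assumes "A \<in> carrier_mat n n" "B \<in> carrier_mat n n" "hermitian_mat A" "hermitian_mat B"
  shows "hermitian_mat (hadamard A B)"
proof (rule hermitian_matI)
  fix i j assume "i < n" "j < n"
  then show "hadamard A B $$ (i, j) = cnj (hadamard A B $$ (j, i))"
    using assms hermitian_matD[of A n i j] hermitian_matD[of B n i j] by (simp add: hadamard_def)
qed (use assms in simp)

lemma quad_form_hadamard:
  assumes A: "A \<in> carrier_mat n n" and B: "B \<in> carrier_mat n n"
    and equiv: "unitarily_equiv B (real_diag_mat n \<mu>) V"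
    and x: "x \<in> carrier_vec n"
  shows "quad_form (hadamard A B) x =
    (\<Sum>m<n. \<mu> m * quad_form A (component_mult (conjugate (col V m)) x))"
proof -
  note V = unitarily_equivD[OF equiv B]
  note V_carrier = unitary_matD(1)[OF V(1)]
  let ?y = "\<lambda>m. component_mult (conjugate (col V m)) x"
  have y: "?y m \<in> carrier_vec n" "\<And>i. i < n \<Longrightarrow> ?y m $ i = cnj (V $$ (i, m)) * x $ i" if "m < n" for m
    using V_carrier x that by (auto simp: component_mult_def)
  have B_index: "B $$ (i, j) = (\<Sum>m<n. complex_of_real (\<mu> m) * V $$ (i, m) * cnj (V $$ (j, m)))"
    if "i < n" "j < n" for i j
    using V_carrier that unfolding V(3) mat_diag_mult_right[OF V_carrier]
    by (simp add: scalar_prod_def atLeast0LessThan mult_ac)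
  let ?q = "\<lambda>m i j. cnj (?y m $ i) * A $$ (i, j) * ?y m $ j"
  have "(\<Sum>i<n. \<Sum>j<n. cnj (x $ i) * hadamard A B $$ (i, j) * x $ j) =
      (\<Sum>i<n. \<Sum>j<n. \<Sum>m<n. complex_of_real (\<mu> m) * ?q m i j)"
    using A by (intro sum.cong refl)
      (simp add: hadamard_def B_index y sum_distrib_left sum_distrib_right mult_ac)
  also have "\<dots> = (\<Sum>i<n. \<Sum>m<n. \<Sum>j<n. complex_of_real (\<mu> m) * ?q m i j)"
    by (rule sum.cong[OF refl], rule sum.swap)
  also have "\<dots> = (\<Sum>m<n. \<Sum>i<n. \<Sum>j<n. complex_of_real (\<mu> m) * ?q m i j)"
    by (rule sum.swap)
  also have "\<dots> = (\<Sum>m<n. complex_of_real (\<mu> m) * (\<Sum>i<n. \<Sum>j<n. ?q m i j))"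
    by (simp add: sum_distrib_left)
  finally show ?thesis
    using A x y(1) by (simp add: quad_form_eq_sum[of _ n])
qed

lemma sum_sq_norm_component_mult_unitary:
  assumes V: "unitary_mat n V" and x: "x \<in> carrier_vec n"
  shows "(\<Sum>m<n. sq_norm (component_mult (conjugate (col V m)) x)) = sq_norm x"
proof -
  have "unitarily_equiv (1\<^sub>m n) (real_diag_mat n (\<lambda>_. 1)) V"
    using unitary_matD[OF V] by (auto simp: unitarily_equiv_def intro!: similar_mat_witI[of _ _ n])
  from quad_form_hadamard[OF one_carrier_mat one_carrier_mat this x]
  have "quad_form (hadamard (1\<^sub>m n) (1\<^sub>m n)) x =
      (\<Sum>m<n. quad_form (1\<^sub>m n) (component_mult (conjugate (col V m)) x))"
    by simp
  moreover have "hadamard (1\<^sub>m n) (1\<^sub>m n) = 1\<^sub>m n"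
    by (rule eq_matI) (auto simp: hadamard_def)
  moreover have "component_mult (conjugate (col V m)) x \<in> carrier_vec n" for m
    using unitary_mat_col_carrier[OF V] x by simp
  ultimately show ?thesis
    using x by (simp add: quad_form_one)
qed

lemma weighted_sum_le_of_head_tail_bounds:
  fixes w q N :: "nat \<Rightarrow> real"
  assumes w: "\<And>m. m < n \<Longrightarrow> 0 \<le> w m" "\<And>m. m < n \<Longrightarrow> w m \<le> M"
    and N: "\<And>m. m < n \<Longrightarrow> 0 \<le> N m" and nonneg: "0 \<le> a" "0 \<le> b"
    and head: "\<And>m. m < n \<Longrightarrow> m < k \<Longrightarrow> q m \<le> a * N m"
    and tail: "\<And>m. m < n \<Longrightarrow> k \<le> m \<Longrightarrow> q m \<le> b * N m"
  shows "(\<Sum>m<n. w m * q m) \<le> (a * M + b * (\<Sum>m\<in>{k..<n}. w m)) * (\<Sum>m<n. N m)"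
proof -
  define S where "S = (\<Sum>m<n. N m)"
  have summand_le: "w m * q m \<le> M * (a * N m) + (if k \<le> m then w m * (b * S) else 0)"
    if m: "m < n" for m
  proof (cases "k \<le> m")
    case True
    have "N m \<le> S"
      unfolding S_def using m N by (intro member_le_sum) auto
    then have "q m \<le> b * S"
      using tail[OF m True] nonneg(2) by (meson mult_left_mono order_trans)
    then have "w m * q m \<le> w m * (b * S)"
      using w(1)[OF m] by (rule mult_left_mono)
    moreover have "0 \<le> M * (a * N m)"
      using order_trans[OF w[OF m]] nonneg(1) N[OF m] by simp
    ultimately show ?thesis
      using True by simp
  next
    case False
    then have "w m * q m \<le> M * (a * N m)"
      using head[OF m] w[OF m] nonneg(1) N[OF m]
      by (meson mult_left_mono mult_nonneg_nonneg mult_right_mono not_le order_trans)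
    then show ?thesis
      using False by simp
  qed
  have "(\<Sum>m<n. w m * q m) \<le>
      (\<Sum>m<n. M * (a * N m) + (if k \<le> m then w m * (b * S) else 0))"
    using summand_le by (intro sum_mono) simp
  also have "\<dots> = (\<Sum>m<n. M * (a * N m)) + (\<Sum>m\<in>{k..<n}. w m * (b * S))"
    unfolding sum.distrib
    by (intro arg_cong2[of _ _ _ _ "(+)"] refl sum.mono_neutral_cong_right) auto
  also have "\<dots> = M * (a * S) + (\<Sum>m\<in>{k..<n}. w m) * (b * S)"
    unfolding sum_distrib_right[symmetric] by (simp add: S_def sum_distrib_left)
  finally show ?thesis
    by (simp add: S_def algebra_simps)
qed

lemma quad_form_component_mult_le_of_orthogonal:
  assumes A: "A \<in> carrier_mat n n" "unitarily_equiv A (real_diag_mat n d) U"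
    and carrier: "v \<in> carrier_vec n" "x \<in> carrier_vec n"
    and orth: "\<And>l. l < n \<Longrightarrow> c < d l \<Longrightarrow> conjugate (component_mult (col U l) v) \<bullet> x = 0"
  shows "quad_form A (component_mult (conjugate v) x) \<le> c * sq_norm (component_mult (conjugate v) x)"
proof (rule quad_form_le_of_spectral_support[OF A])
  show "component_mult (conjugate v) x \<in> carrier_vec n"
    using carrier by simp
  fix l assume l: "l < n" "(mat_adjoint U *\<^sub>v component_mult (conjugate v) x) $ l \<noteq> 0"
  have "(mat_adjoint U *\<^sub>v component_mult (conjugate v) x) $ l =
      conjugate (component_mult (col U l) v) \<bullet> x"
    using unitary_matD(1)[OF unitarily_equivD(1)[OF A(2,1)]] carrier l(1)
    by (simp add: component_mult_def scalar_prod_def mult.assoc)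
  then show "d l \<le> c"
    using orth l by (metis not_le)
qed

lemma quad_form_hadamard_le:
  assumes A: "A \<in> carrier_mat n n" "unitarily_equiv A (real_diag_mat n \<sigma>) U"
    and B: "B \<in> carrier_mat n n" "unitarily_equiv B (real_diag_mat n \<mu>) V"
    and \<sigma>: "\<And>l. l < n \<Longrightarrow> \<sigma> l \<le> b" and \<mu>: "\<And>m. m < n \<Longrightarrow> 0 \<le> \<mu> m" "\<And>m. m < n \<Longrightarrow> \<mu> m \<le> M"
    and nonneg: "0 \<le> a" "0 \<le> b" and x: "x \<in> carrier_vec n"
    and orth: "\<And>l m. l < n \<Longrightarrow> a < \<sigma> l \<Longrightarrow> m < n \<Longrightarrow> m < k \<Longrightarrow>
      conjugate (component_mult (col U l) (col V m)) \<bullet> x = 0"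
  shows "quad_form (hadamard A B) x \<le> (a * M + b * (\<Sum>m\<in>{k..<n}. \<mu> m)) * sq_norm x"
proof -
  note V = unitarily_equivD(1)[OF B(2,1)]
  note col = unitary_mat_col_carrier[OF V]
  show ?thesis
    unfolding quad_form_hadamard[OF A(1) B x] sum_sq_norm_component_mult_unitary[OF V x, symmetric]
  proof (rule weighted_sum_le_of_head_tail_bounds[OF \<mu> sq_norm_nonneg nonneg])
    fix m assume m: "m < n"
    let ?y = "component_mult (conjugate (col V m)) x"
    show "quad_form A ?y \<le> a * sq_norm ?y" if "m < k"
      using m that orth by (intro quad_form_component_mult_le_of_orthogonal[OF A col x]) simp
    show "quad_form A ?y \<le> b * sq_norm ?y"
      using \<sigma> col x by (intro quad_form_le_of_spectral_support[OF A]) simp_all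
  qed
qed

theorem eig_lambda_hadamard_le:
  assumes A: "A \<in> carrier_mat n n" "psd_mat A" and B: "B \<in> carrier_mat n n" "psd_mat B"
    and k: "1 \<le> k" "s * k < n"
  shows "eig_lambda (Suc (s * k)) (hadamard A B) \<le>
    eig_lambda (Suc s) A * eig_lambda 1 B + eig_lambda 1 A * (\<Sum>j\<in>{k<..n}. eig_lambda j B)"
proof -
  have hermitian: "hermitian_mat A" "hermitian_mat B"
    using A B by (auto simp: psd_mat_def)
  have n: "0 < n" "s < n"
    using k mult_le_mono2[OF k(1), of s] by linarith+
  define \<sigma> where "\<sigma> l = eig_lambda (Suc l) A" for l
  define \<mu> where "\<mu> m = eig_lambda (Suc m) B" for m
  obtain U where U: "unitarily_equiv A (real_diag_mat n \<sigma>) U"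
    using hermitian_mat_spectral[OF A(1) hermitian(1)] unfolding \<sigma>_def .
  obtain V where V: "unitarily_equiv B (real_diag_mat n \<mu>) V"
    using hermitian_mat_spectral[OF B(1) hermitian(2)] unfolding \<mu>_def .
  note col = unitarily_equivD(1)[OF U A(1), THEN unitary_mat_col_carrier]
    unitarily_equivD(1)[OF V B(1), THEN unitary_mat_col_carrier]
  have nonneg: "0 \<le> \<sigma> l" "0 \<le> \<mu> l" if "l < n" for l
    using psd_mat_eig_lambda_nonneg A B that by (auto simp: \<sigma>_def \<mu>_def)
  have antimono: "\<sigma> m \<le> \<sigma> l" "\<mu> m \<le> \<mu> l" if "l \<le> m" "m < n" for l m
    using eig_lambda_antimono A(1) B(1) that by (auto simp: \<sigma>_def \<mu>_def)
  define W where "W = (\<lambda>(l, m). conjugate (component_mult (col U l) (col V m))) ` ({..<s} \<times> {..<k})"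
  have "eig_lambda (Suc (s * k)) (hadamard A B) \<le> \<sigma> s * \<mu> 0 + \<sigma> 0 * (\<Sum>m\<in>{k..<n}. \<mu> m)"
  proof (rule eig_lambda_le_of_quad_form_le)
    show "finite W" "W \<subseteq> carrier_vec n"
      using col by (auto simp: W_def)
    show "card W \<le> s * k"
      unfolding W_def using card_image_le[of "{..<s} \<times> {..<k}"] by simp
    fix x assume x: "x \<in> carrier_vec n" and orth: "\<And>w. w \<in> W \<Longrightarrow> w \<bullet> x = 0"
    show "quad_form (hadamard A B) x \<le> (\<sigma> s * \<mu> 0 + \<sigma> 0 * (\<Sum>m\<in>{k..<n}. \<mu> m)) * sq_norm x"
    proof (rule quad_form_hadamard_le[OF A(1) U B(1) V])
      fix l m assume "l < n" "\<sigma> s < \<sigma> l" "m < k"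
      then have "(l, m) \<in> {..<s} \<times> {..<k}"
        using antimono(1)[of s l] by (auto simp: not_le[symmetric])
      then show "conjugate (component_mult (col U l) (col V m)) \<bullet> x = 0"
        by (intro orth) (auto simp: W_def)
    qed (use nonneg antimono n x in auto)
  qed (use A B k hermitian hermitian_mat_hadamard in auto)
  moreover have "(\<Sum>m\<in>{k..<n}. \<mu> m) = (\<Sum>j\<in>{k<..n}. eig_lambda j B)"
    unfolding \<mu>_def by (rule sum.reindex_bij_witness[of _ "\<lambda>j. j - 1" Suc]) auto
  ultimately show ?thesis
    by (simp add: \<sigma>_def \<mu>_def)
qed

lemma exp_decay_of_exp_decay_along_multiples:
  fixes f :: "nat \<Rightarrow> real"
  assumes antimono: "\<And>i j. 1 \<le> i \<Longrightarrow> i \<le> j \<Longrightarrow> j \<le> n \<Longrightarrow> f j \<le> f i"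
    and bound: "\<And>s. s * k < n \<Longrightarrow> f (Suc (s * k)) \<le> K * exp (- \<beta> * real s)"
    and nonneg: "0 \<le> K" "0 \<le> \<beta>" and j: "1 \<le> j" "j \<le> n" and k: "1 \<le> k" "s * k \<le> j"
  shows "f j \<le> K * exp \<beta> * exp (- \<beta> * real s)"
proof -
  define t where "t = s - 1"
  have tk: "Suc (t * k) \<le> j"
    using j(1) k by (cases s) (simp_all add: t_def)
  have "f j \<le> f (Suc (t * k))"
    using antimono tk j(2) by simp
  also have "\<dots> \<le> K * exp (- \<beta> * real t)"
    using bound tk j(2) by simp
  also have "\<dots> \<le> K * exp (\<beta> + - \<beta> * real s)"
  proof -
    have "\<beta> * real s \<le> \<beta> * (1 + real t)"
      using nonneg(2) by (intro mult_left_mono) (simp_all add: t_def)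
    then show ?thesis
      using nonneg(1) by (intro mult_left_mono) (simp_all add: algebra_simps)
  qed
  finally show ?thesis
    unfolding exp_add by simp
qed

lemma eig_lambda_hadamard_exp_decay_along_multiples:
  fixes C \<alpha> C' c' :: real
  assumes A: "A \<in> carrier_mat n n" "psd_mat A" and B: "B \<in> carrier_mat n n" "psd_mat B"
    and k: "1 \<le> k" "s * k < n" and nonneg: "0 \<le> C" "0 \<le> \<alpha>" "0 \<le> c'"
    and A_decay: "\<And>j. 1 \<le> j \<Longrightarrow> j \<le> n \<Longrightarrow> eig_lambda j A \<le> C * exp (- \<alpha> * real j)"
    and B_head: "eig_lambda 1 B \<le> C'"
    and B_tail: "(\<Sum>j\<in>{k<..n}. eig_lambda j B) \<le> exp (- c' * real n)"
  shows "eig_lambda (Suc (s * k)) (hadamard A B) \<le> C * (C' + 1) * exp (- min \<alpha> c' * real s)"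
proof -
  define \<beta> where "\<beta> = min \<alpha> c'"
  have s: "s < n"
    using k mult_le_mono2[OF k(1), of s] by linarith
  have B_nonneg: "0 \<le> eig_lambda j B" if "1 \<le> j" "j \<le> n" for j
    using psd_mat_eig_lambda_nonneg[OF B, of "j - 1"] that by simp
  have "\<beta> * real s \<le> \<alpha> * real (Suc s)"
    unfolding \<beta>_def using nonneg by (intro mult_mono) auto
  then have "C * exp (- \<alpha> * real (Suc s)) \<le> C * exp (- \<beta> * real s)"
    using nonneg(1) by (intro mult_left_mono) auto
  then have A_s: "eig_lambda (Suc s) A \<le> C * exp (- \<beta> * real s)"
    using A_decay[of "Suc s"] s by linarith
  have "C * exp (- \<alpha> * real 1) \<le> C * 1"
    using nonneg by (intro mult_left_mono) auto
  then have A_1: "eig_lambda 1 A \<le> C"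
    using A_decay[of 1] s by linarith
  have "\<beta> * real s \<le> c' * real n"
    unfolding \<beta>_def using nonneg s by (intro mult_mono) auto
  then have tail: "(\<Sum>j\<in>{k<..n}. eig_lambda j B) \<le> exp (- \<beta> * real s)"
    using B_tail by (elim order_trans) simp
  have "eig_lambda (Suc (s * k)) (hadamard A B) \<le>
      eig_lambda (Suc s) A * eig_lambda 1 B + eig_lambda 1 A * (\<Sum>j\<in>{k<..n}. eig_lambda j B)"
    by (rule eig_lambda_hadamard_le[OF A B k])
  also have "\<dots> \<le> C * exp (- \<beta> * real s) * C' + C * exp (- \<beta> * real s)"
    using A_s A_1 B_head tail B_nonneg nonneg s by (intro add_mono mult_mono sum_nonneg) auto
  finally show ?thesis
    by (simp add: \<beta>_def algebra_simps)
qed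

lemma eig_lambda_hadamard_exp_decay:
  fixes C \<alpha> C' c' :: real
  assumes A: "A \<in> carrier_mat n n" "psd_mat A" and B: "B \<in> carrier_mat n n" "psd_mat B"
    and k: "1 \<le> k" and nonneg: "0 \<le> C" "0 \<le> \<alpha>" "0 \<le> C'" "0 \<le> c'"
    and A_decay: "\<And>j. 1 \<le> j \<Longrightarrow> j \<le> n \<Longrightarrow> eig_lambda j A \<le> C * exp (- \<alpha> * real j)"
    and B_head: "eig_lambda 1 B \<le> C'"
    and B_tail: "(\<Sum>j\<in>{k<..n}. eig_lambda j B) \<le> exp (- c' * real n)"
    and j: "1 \<le> j" "j \<le> n" "s * k \<le> j"
  shows "eig_lambda j (hadamard A B) \<le> C * (C' + 1) * exp (min \<alpha> c') * exp (- min \<alpha> c' * real s)"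
proof (rule exp_decay_of_exp_decay_along_multiples[where n = n])
  fix i j :: nat assume "1 \<le> i" "i \<le> j" "j \<le> n"
  then show "eig_lambda j (hadamard A B) \<le> eig_lambda i (hadamard A B)"
    using eig_lambda_antimono[OF hadamard_carrier[OF A(1)], of "i - 1" "j - 1"] by simp
next
  fix s assume "s * k < n"
  then show "eig_lambda (Suc (s * k)) (hadamard A B) \<le> C * (C' + 1) * exp (- min \<alpha> c' * real s)"
    using eig_lambda_hadamard_exp_decay_along_multiples[OF A B k _ nonneg(1,2,4)]
      A_decay B_head B_tail by blast
qed (use k nonneg j in auto)

theorem mainTheorem9:
  fixes C \<alpha> C' c' :: real
  assumes "C > 0" and "\<alpha> > 0" and "C' > 0" and "c' > 0"
  shows "\<exists>K \<alpha>'. K > 0 \<and> \<alpha>' > 0 \<and>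
    (\<forall>(W::nat) (kstar::nat) (A::complex mat) (B::complex mat).
       1 \<le> W \<and> 1 \<le> kstar \<and> kstar \<le> W \<and>
       A \<in> carrier_mat W W \<and> B \<in> carrier_mat W W \<and>
       psd_mat A \<and> psd_mat B \<and>
       (\<forall>j. 1 \<le> j \<and> j \<le> W \<longrightarrow> eig_lambda j A \<le> C * exp (- \<alpha> * real j)) \<and>
       (\<forall>j. 1 \<le> j \<and> j \<le> kstar \<longrightarrow> eig_lambda j B \<le> C') \<and>
       (\<Sum>j\<in>{kstar<..W}. eig_lambda j B) \<le> exp (- c' * real W)
       \<longrightarrow>
       (\<forall>s::nat. 1 \<le> s \<and> s * kstar + 1 \<le> W \<longrightarrow>
          eig_lambda (s * kstar + 1) (hadamard A B) \<le> K * exp (- \<alpha>' * real s)) \<and>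
       (\<forall>k::nat. kstar \<le> k \<and> k \<le> W \<longrightarrow>
          eig_lambda k (hadamard A B) \<le> K * exp (- \<alpha>' * real (k div kstar))))"
proof -
  define \<beta> where "\<beta> = min \<alpha> c'"
  define K where "K = C * (C' + 1) * exp \<beta>"
  have pos: "0 < K" "0 < \<beta>"
    using assms by (simp_all add: K_def \<beta>_def)
  show ?thesis
  proof (rule exI[of _ K], rule exI[of _ \<beta>], intro conjI impI allI; (elim conjE)?)
    fix W kstar :: nat and A B :: "complex mat"
    assume "A \<in> carrier_mat W W" "psd_mat A" "B \<in> carrier_mat W W" "psd_mat B" and kstar: "1 \<le> kstar"
      and "\<forall>j. 1 \<le> j \<and> j \<le> W \<longrightarrow> eig_lambda j A \<le> C * exp (- \<alpha> * real j)"
      and "\<forall>j. 1 \<le> j \<and> j \<le> kstar \<longrightarrow> eig_lambda j B \<le> C'"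
      and "(\<Sum>j\<in>{kstar<..W}. eig_lambda j B) \<le> exp (- c' * real W)"
    then have decay: "eig_lambda j (hadamard A B) \<le> K * exp (- \<beta> * real s)"
      if "1 \<le> j" "j \<le> W" "s * kstar \<le> j" for j s
      unfolding K_def \<beta>_def using assms that by (intro eig_lambda_hadamard_exp_decay) auto
    show "eig_lambda (s * kstar + 1) (hadamard A B) \<le> K * exp (- \<beta> * real s)"
      if "s * kstar + 1 \<le> W" for s
      using that by (intro decay) simp_all
    show "eig_lambda k (hadamard A B) \<le> K * exp (- \<beta> * real (k div kstar))"
      if "kstar \<le> k" "k \<le> W" for k
      using kstar that by (intro decay) simp_all
  qed (rule pos)+
qed

end
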